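(* Let $k\geq1$. A family $\overrightarrow C=(C_{\bar a})_{\bar a\in A^k}\in V_k$ belongs to $X_k$ if and only if there exists an ultrafilter $\gamma\in\beta(A^* )$ such that for every $\bar a\in A^k$ and every $Q\subseteq\mathbb N^k$: $C_{\bar a}\subseteq\widehat Q$ if and only if $L_{\Box^{\bar a}_Q}\in\gamma$; or, equivalently, $C_{\bar a}\cap\widehat Q\neq\emptyset$ if and only if $L_{\Diamond^{\bar a}_Q}\in\gamma$.
   Context: $A$ is a finite alphabet. For $\bar a\in A^k$, $w\in A^*$: $c_{\bar a}(w):=\{\bar i\in\mathbb N^k: i_j<|w|, w_{i_j}=a_j\ \forall j\}$. For $Q\subseteq\mathbb N^k$: $L_{\Diamond^{\bar a}_Q}:=\{w: c_{\bar a}(w)\cap Q\neq\emptyset\}$ and $L_{\Box^{\bar a}_Q}:=\{w: c_{\bar a}(w)\subseteq Q\}$. $\beta(S)$ is the space of ultrafilters on a set $S$ with clopens $\widehat Q=\{\alpha: Q\in\alpha\}$; $\mathcal V(X)$ is the Vietoris hyperspace of closed subsets of $X$; $V_k:=\mathcal V(\beta(\mathbb N^k))^{A^k}$. $c^k:\beta(A^* )\to V_k$ is the unique continuous extension of $w\mapsto(\widehat{c_{\bar a}(w)})_{\bar a}$. $X_k$ denotes the dual space of the Boolean algebra $\mathcal B_k\subseteq\mathcal P(A^* )$ generated by all $L_{\Diamond^{\bar a}_Q}$, identified with the subspace $c^k(\beta(A^* ))$ of $V_k$. *)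

theory Defs
  imports "HOL-Analysis.Analysis"
begin

definition ultrafilter_on :: "'a set \<Rightarrow> 'a set set \<Rightarrow> bool" where
  "ultrafilter_on S F \<longleftrightarrow>
     F \<subseteq> Pow S \<and> S \<in> F \<and> {} \<notin> F \<and>
     (\<forall>P\<in>F. \<forall>Q\<in>F. P \<inter> Q \<in> F) \<and>
     (\<forall>P\<in>F. \<forall>Q. P \<subseteq> Q \<and> Q \<subseteq> S \<longrightarrow> Q \<in> F) \<and>
     (\<forall>Q. Q \<subseteq> S \<longrightarrow> Q \<in> F \<or> S - Q \<in> F)"

definition hat :: "'a set \<Rightarrow> 'a set \<Rightarrow> 'a set set set" where
  "hat S Q = {\<alpha>. ultrafilter_on S \<alpha> \<and> Q \<in> \<alpha>}"

definition beta :: "'a set \<Rightarrow> 'a set set topology" where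
  "beta S = topology_generated_by {hat S Q | Q. Q \<subseteq> S}"

definition principal_ultrafilter :: "'a set \<Rightarrow> 'a \<Rightarrow> 'a set set" where
  "principal_ultrafilter S x = {Q. Q \<subseteq> S \<and> x \<in> Q}"

text \<open>The Vietoris hyperspace; the empty set is one of its points, since
  \<open>c\<^bsub>a\<^esub>(w)\<close> below may be empty.\<close>

definition vietoris :: "'a topology \<Rightarrow> 'a set topology" where
  "vietoris X = topology_generated_by
     ({{C. closedin X C \<and> C \<subseteq> U} | U. openin X U} \<union>
      {{C. closedin X C \<and> C \<inter> U \<noteq> {}} | U. openin X U})"

text \<open>\<open>k\<close>-tuples over \<open>S\<close> are lists of length \<open>k\<close>; the words over the alphabet \<open>A\<close>
  are \<open>lists A\<close>.\<close>

definition tuples :: "nat \<Rightarrow> 'a set \<Rightarrow> 'a list set" where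
  "tuples k S = {xs. length xs = k \<and> set xs \<subseteq> S}"

abbreviation nat_tuples :: "nat \<Rightarrow> nat list set" where
  "nat_tuples k \<equiv> tuples k UNIV"

definition cpos :: "'a list \<Rightarrow> 'a list \<Rightarrow> nat list set" where
  "cpos a w = {i \<in> nat_tuples (length a).
     \<forall>j<length a. i ! j < length w \<and> w ! (i ! j) = a ! j}"

definition L_diamond :: "'a set \<Rightarrow> 'a list \<Rightarrow> nat list set \<Rightarrow> 'a list set" where
  "L_diamond A a Q = {w \<in> lists A. cpos a w \<inter> Q \<noteq> {}}"

definition L_box :: "'a set \<Rightarrow> 'a list \<Rightarrow> nat list set \<Rightarrow> 'a list set" where
  "L_box A a Q = {w \<in> lists A. cpos a w \<subseteq> Q}"

definition V_space ::
    "'a set \<Rightarrow> nat \<Rightarrow> ('a list \<Rightarrow> nat list set set set) topology" where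
  "V_space A k = product_topology (\<lambda>a. vietoris (beta (nat_tuples k))) (tuples k A)"

text \<open>The continuous extension along the embedding of \<open>A\<^sup>*\<close> into \<open>\<beta>(A\<^sup>*)\<close> as principal
  ultrafilters. It is unique only as a function on the points of \<open>\<beta>(A\<^sup>*)\<close>; extensionality
  fixes it outside them.\<close>

definition c_ext ::
    "'a set \<Rightarrow> nat \<Rightarrow> 'a list set set \<Rightarrow> 'a list \<Rightarrow> nat list set set set" where
  "c_ext A k = (THE f.
     f \<in> extensional (topspace (beta (lists A))) \<and>
     continuous_map (beta (lists A)) (V_space A k) f \<and>
     (\<forall>w\<in>lists A. f (principal_ultrafilter (lists A) w) =
        (\<lambda>a\<in>tuples k A. hat (nat_tuples k) (cpos a w))))"

text \<open>The dual space of the Boolean algebra generated by the languages \<open>L_diamond A a Q\<close>,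
  in its realization as a subspace of \<open>V_space A k\<close>.\<close>

definition X_space ::
    "'a set \<Rightarrow> nat \<Rightarrow> ('a list \<Rightarrow> nat list set set set) topology" where
  "X_space A k = subtopology (V_space A k) (c_ext A k ` topspace (beta (lists A)))"

end

theory Submission
  imports Defs
begin

text \<open>
  An ultrafilter \<open>\<gamma>\<close> on the words and a tuple \<open>a\<close> determine the filter of all \<open>Q\<close> with
  \<open>L_box A a Q \<in> \<gamma>\<close>; let \<open>box_cluster A k \<gamma> a\<close> be the set of ultrafilters extending it. By
  compactness, \<open>box_cluster A k \<gamma> a\<close> lies in an open set \<open>U\<close> iff some such \<open>Q\<close> has its clopen
  inside \<open>U\<close>. Hence \<open>box_cluster\<close> is continuous in \<open>\<gamma>\<close>, so it is the extension \<open>c_ext\<close>, and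
  it lies in the clopen of \<open>Q\<close> iff \<open>L_box A a Q \<in> \<gamma>\<close>. Since a closed set of ultrafilters is
  the intersection of the clopens containing it, this property characterises the image of \<open>\<gamma>\<close>.
\<close>

section \<open>Ultrafilters\<close>

lemma ultrafilter_onD:
  assumes "ultrafilter_on S F"
  shows "F \<subseteq> Pow S" "S \<in> F" "{} \<notin> F"
    and "\<And>P Q. P \<in> F \<Longrightarrow> Q \<in> F \<Longrightarrow> P \<inter> Q \<in> F"
    and "\<And>P Q. P \<in> F \<Longrightarrow> P \<subseteq> Q \<Longrightarrow> Q \<subseteq> S \<Longrightarrow> Q \<in> F"
    and "\<And>Q. Q \<subseteq> S \<Longrightarrow> Q \<in> F \<or> S - Q \<in> F"
  using assms unfolding ultrafilter_on_def by simp_all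

lemma ultrafilter_on_Compl_iff:
  assumes "ultrafilter_on S F" "Q \<subseteq> S"
  shows "S - Q \<in> F \<longleftrightarrow> Q \<notin> F"
  using ultrafilter_onD(3,4,6)[OF assms(1)] assms(2) by (metis Diff_disjoint)

lemma ultrafilter_on_principal:
  assumes "x \<in> S"
  shows "ultrafilter_on S (principal_ultrafilter S x)"
  using assms unfolding ultrafilter_on_def principal_ultrafilter_def by auto

text \<open>The finite intersection property relative to \<open>S\<close>. Intersecting with
  \<open>S\<close> gives the empty \<open>H\<close> its intended meaning: its intersection is
  \<open>S\<close> and not the universe, so \<open>S\<close> itself must be nonempty.\<close>

definition fip_on :: "'a set \<Rightarrow> 'a set set \<Rightarrow> bool" where
  "fip_on S F \<longleftrightarrow> F \<subseteq> Pow S \<and> (\<forall>H. finite H \<and> H \<subseteq> F \<longrightarrow> S \<inter> \<Inter>H \<noteq> {})"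

lemma fip_on_insert:
  assumes "fip_on S F" "Q \<subseteq> S" "\<And>H. finite H \<Longrightarrow> H \<subseteq> F \<Longrightarrow> S \<inter> \<Inter>H \<inter> Q \<noteq> {}"
  shows "fip_on S (insert Q F)"
  unfolding fip_on_def
proof (intro conjI allI impI)
  show "insert Q F \<subseteq> Pow S"
    using assms(1,2) by (auto simp: fip_on_def)
  fix H assume H: "finite H \<and> H \<subseteq> insert Q F"
  then have "S \<inter> \<Inter>(H - {Q}) \<inter> Q \<noteq> {}"
    by (intro assms(3)) auto
  then show "S \<inter> \<Inter>H \<noteq> {}"
    by blast
qed

text \<open>By maximality, \<open>M\<close> contains every subset of \<open>S\<close> that can be
  added without losing the finite intersection property. Hence \<open>M\<close> equals the filter it
  generates (\<open>mem_iff\<close>), and each filter axiom follows by exhibiting a suitable finite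
  \<open>H\<close>.\<close>

lemma maximal_fip_imp_ultrafilter_on:
  assumes fip: "fip_on S M" and max: "\<And>N. fip_on S N \<Longrightarrow> M \<subseteq> N \<Longrightarrow> N = M"
  shows "ultrafilter_on S M"
proof -
  have mem_iff: "Q \<in> M \<longleftrightarrow> (\<exists>H. finite H \<and> H \<subseteq> M \<and> S \<inter> \<Inter>H \<subseteq> Q)" if Q: "Q \<subseteq> S" for Q
  proof
    assume "Q \<in> M"
    then show "\<exists>H. finite H \<and> H \<subseteq> M \<and> S \<inter> \<Inter>H \<subseteq> Q"
      by (intro exI[of _ "{Q}"]) auto
  next
    assume "\<exists>H. finite H \<and> H \<subseteq> M \<and> S \<inter> \<Inter>H \<subseteq> Q"
    then obtain H where H: "finite H" "H \<subseteq> M" "S \<inter> \<Inter>H \<subseteq> Q" by blast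
    have "fip_on S (insert Q M)"
    proof (rule fip_on_insert[OF fip Q])
      fix H' assume H': "finite H'" "H' \<subseteq> M"
      \<comment> \<open>A common point of \<open>H\<close> and \<open>H'\<close> lies in
        \<open>Q\<close> because of \<open>H\<close>, so adding \<open>Q\<close> to \<open>M\<close>
        is harmless.\<close>
      then have "S \<inter> \<Inter>(H \<union> H') \<noteq> {}"
        using fip H(1,2) by (simp add: fip_on_def)
      then show "S \<inter> \<Inter>H' \<inter> Q \<noteq> {}"
        using H(3) by blast
    qed
    then show "Q \<in> M"
      using max by blast
  qed
  have sub: "M \<subseteq> Pow S"
    using fip by (simp add: fip_on_def)
  show ?thesis
    unfolding ultrafilter_on_def
  proof (intro conjI ballI allI impI)
    show "M \<subseteq> Pow S" by (fact sub)
    show "S \<in> M"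
      by (subst mem_iff) (auto intro!: exI[of _ "{}"])
    show "{} \<notin> M"
    proof
      assume "{} \<in> M"
      then have "S \<inter> \<Inter>{{}} \<noteq> {}"
        using fip unfolding fip_on_def by (metis empty_subsetI finite.simps insert_subset)
      then show False by simp
    qed
  next
    fix P Q assume PQ: "P \<in> M" "Q \<in> M"
    then have "P \<inter> Q \<subseteq> S"
      using sub by blast
    then show "P \<inter> Q \<in> M"
      using PQ by (subst mem_iff) (auto intro!: exI[of _ "{P, Q}"])
  next
    fix P Q assume PQ: "P \<in> M" "P \<subseteq> Q \<and> Q \<subseteq> S"
    then show "Q \<in> M"
      by (subst mem_iff) (auto intro!: exI[of _ "{P}"])
  next
    fix Q assume Q: "Q \<subseteq> S"
    show "Q \<in> M \<or> S - Q \<in> M"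
    proof (cases "fip_on S (insert Q M)")
      case True
      then show ?thesis using max by blast
    next
      case False
      \<comment> \<open>The obstruction to adding \<open>Q\<close> is a finite intersection from
        \<open>M\<close> that misses \<open>Q\<close>; it lies in \<open>S - Q\<close> and so forces
        this complement into \<open>M\<close>.\<close>
      then obtain H where "finite H" "H \<subseteq> M" "S \<inter> \<Inter>H \<inter> Q = {}"
        using fip_on_insert[OF fip Q] by blast
      then have "S - Q \<in> M"
        by (subst mem_iff) (auto intro!: exI[of _ H])
      then show ?thesis ..
    qed
  qed
qed

text \<open>Zorn's lemma, applied to the families above \<open>B\<close> with the finite
  intersection property. The union of a chain keeps the property because a finite subfamily of the
  union already lies in one member of the chain.\<close>

lemma fip_extends_to_ultrafilter:
  assumes "fip_on S B"
  obtains F where "ultrafilter_on S F" "B \<subseteq> F"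
proof -
  let ?\<A> = "{F. fip_on S F \<and> B \<subseteq> F}"
  have "\<exists>M\<in>?\<A>. \<forall>X\<in>?\<A>. M \<subseteq> X \<longrightarrow> X = M"
  proof (rule subset_Zorn_nonempty)
    show "?\<A> \<noteq> {}" using assms by blast
  next
    fix \<C> assume ne: "\<C> \<noteq> {}" and chain: "subset.chain ?\<A> \<C>"
    have mem: "fip_on S F" "B \<subseteq> F" if "F \<in> \<C>" for F
      using chain that unfolding subset.chain_def by auto
    have "fip_on S (\<Union>\<C>)"
      unfolding fip_on_def
    proof (intro conjI allI impI)
      show "\<Union>\<C> \<subseteq> Pow S"
        using mem(1) unfolding fip_on_def by blast
      fix H assume H: "finite H \<and> H \<subseteq> \<Union>\<C>"
      then obtain F where "F \<in> \<C>" "H \<subseteq> F"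
        using finite_subset_Union_chain[OF _ _ ne chain] by metis
      then show "S \<inter> \<Inter>H \<noteq> {}"
        using mem(1)[of F] H by (simp add: fip_on_def)
    qed
    then show "\<Union>\<C> \<in> ?\<A>"
      using ne mem(2) by blast
  qed
  then obtain M where M: "fip_on S M" "B \<subseteq> M"
    and max: "\<forall>X\<in>?\<A>. M \<subseteq> X \<longrightarrow> X = M"
    by auto
  have "ultrafilter_on S M"
  proof (rule maximal_fip_imp_ultrafilter_on[OF M(1)])
    fix N assume "fip_on S N" "M \<subseteq> N"
    then show "N = M"
      using max M(2) by simp
  qed
  then show thesis
    using that M(2) by blast
qed

section \<open>The space of ultrafilters and its hyperspace\<close>

text \<open>Principal ultrafilters reflect the inclusion: the one at a point of \<open>P\<close>
  belongs to \<open>hat S P\<close>, and its membership in \<open>hat S Q\<close> puts the point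
  into \<open>Q\<close>.\<close>

lemma hat_subset_hat_iff:
  assumes "P \<subseteq> S" "Q \<subseteq> S"
  shows "hat S P \<subseteq> hat S Q \<longleftrightarrow> P \<subseteq> Q"
proof
  assume sub: "hat S P \<subseteq> hat S Q"
  show "P \<subseteq> Q"
  proof
    fix x assume "x \<in> P"
    then have "principal_ultrafilter S x \<in> hat S P"
      using assms(1) ultrafilter_on_principal[of x S]
      by (auto simp: hat_def principal_ultrafilter_def)
    then show "x \<in> Q"
      using sub by (auto simp: hat_def principal_ultrafilter_def)
  qed
next
  assume "P \<subseteq> Q"
  then show "hat S P \<subseteq> hat S Q"
    using assms by (auto simp: hat_def intro: ultrafilter_onD(5))
qed

lemma openin_beta_hat: "Q \<subseteq> S \<Longrightarrow> openin (beta S) (hat S Q)"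
  unfolding beta_def by (rule topology_generated_by_Basis) blast

lemma topspace_beta: "topspace (beta S) = Collect (ultrafilter_on S)"
proof -
  have "hat S S = Collect (ultrafilter_on S)" "\<And>Q. hat S Q \<subseteq> Collect (ultrafilter_on S)"
    by (auto simp: hat_def dest: ultrafilter_onD(2))
  then show ?thesis
    unfolding beta_def topology_generated_by_topspace by blast
qed

text \<open>The generating sets form a base and not merely a subbase, because \<open>hat S P\<close>
  and \<open>hat S Q\<close> meet in \<open>hat S (P \<inter> Q)\<close>. The proof is an induction
  on the generation of open sets.\<close>

lemma openin_betaE:
  assumes "openin (beta S) U" "\<alpha> \<in> U"
  obtains Q where "Q \<subseteq> S" "\<alpha> \<in> hat S Q" "hat S Q \<subseteq> U"
proof -
  have "generate_topology_on {hat S Q | Q. Q \<subseteq> S} U"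
    using assms(1) unfolding beta_def openin_topology_generated_by_iff .
  then have "\<forall>\<alpha>\<in>U. \<exists>Q. Q \<subseteq> S \<and> \<alpha> \<in> hat S Q \<and> hat S Q \<subseteq> U"
  proof induction
    case Empty
    then show ?case by simp
  next
    case (Int U V)
    show ?case
    proof
      fix \<alpha> assume "\<alpha> \<in> U \<inter> V"
      then have "\<alpha> \<in> U" "\<alpha> \<in> V" by simp_all
      from bspec[OF Int.IH(1) this(1)] bspec[OF Int.IH(2) this(2)]
      obtain P Q where PQ: "P \<subseteq> S" "\<alpha> \<in> hat S P" "hat S P \<subseteq> U"
        "Q \<subseteq> S" "\<alpha> \<in> hat S Q" "hat S Q \<subseteq> V"
        by (elim exE conjE)
      have "\<alpha> \<in> hat S (P \<inter> Q)"
        using PQ(2,5) by (auto simp: hat_def intro: ultrafilter_onD(4))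
      moreover have "hat S (P \<inter> Q) \<subseteq> hat S P \<inter> hat S Q"
        using PQ(1,4) by (simp add: hat_subset_hat_iff le_infI1)
      ultimately show "\<exists>R. R \<subseteq> S \<and> \<alpha> \<in> hat S R \<and> hat S R \<subseteq> U \<inter> V"
        using PQ(1,3,6) by (intro exI[of _ "P \<inter> Q"]) auto
    qed
  next
    case (UN K)
    show ?case
    proof
      fix \<alpha> assume "\<alpha> \<in> \<Union>K"
      then obtain V where V: "V \<in> K" "\<alpha> \<in> V" by blast
      from bspec[OF UN.IH[OF V(1)] V(2)]
      obtain Q where "Q \<subseteq> S" "\<alpha> \<in> hat S Q" "hat S Q \<subseteq> V"
        by (elim exE conjE)
      then show "\<exists>Q. Q \<subseteq> S \<and> \<alpha> \<in> hat S Q \<and> hat S Q \<subseteq> \<Union>K"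
        using V(1) by (intro exI[of _ Q]) auto
    qed
  next
    case (Basis s)
    then show ?case by blast
  qed
  then show thesis
    using assms(2) that by blast
qed

lemma hat_Compl:
  assumes "Q \<subseteq> S"
  shows "hat S (S - Q) = topspace (beta S) - hat S Q"
  using ultrafilter_on_Compl_iff[OF _ assms] by (auto simp: hat_def topspace_beta)

lemma closedin_beta_hat:
  assumes "Q \<subseteq> S"
  shows "closedin (beta S) (hat S Q)"
proof -
  have "hat S Q \<subseteq> topspace (beta S)"
    by (auto simp: hat_def topspace_beta)
  then show ?thesis
    using openin_beta_hat[of "S - Q" S] by (simp add: closedin_def hat_Compl[OF assms])
qed

text \<open>A closed set is the intersection of the clopen sets \<open>hat S Q\<close> containing
  it: a point outside has a basic neighbourhood that misses the set, and the complement of this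
  neighbourhood is again of the form \<open>hat S Q\<close>.\<close>

lemma closedin_beta_eqI:
  assumes "closedin (beta S) C" "closedin (beta S) D"
    and same: "\<And>Q. Q \<subseteq> S \<Longrightarrow> C \<subseteq> hat S Q \<longleftrightarrow> D \<subseteq> hat S Q"
  shows "C = D"
proof -
  have sub: "C' \<subseteq> D'" if C': "closedin (beta S) C'" and D': "closedin (beta S) D'"
    and le: "\<And>Q. Q \<subseteq> S \<Longrightarrow> D' \<subseteq> hat S Q \<Longrightarrow> C' \<subseteq> hat S Q" for C' D'
  proof (rule ccontr)
    assume "\<not> C' \<subseteq> D'"
    then obtain \<alpha> where \<alpha>: "\<alpha> \<in> C'" "\<alpha> \<notin> D'" by blast
    then have "\<alpha> \<in> topspace (beta S) - D'"
      using closedin_subset[OF C'] by blast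
    then obtain Q where Q: "Q \<subseteq> S" "\<alpha> \<in> hat S Q" "hat S Q \<subseteq> topspace (beta S) - D'"
      using openin_betaE D' unfolding closedin_def by metis
    then have "D' \<subseteq> hat S (S - Q)"
      using closedin_subset[OF D'] by (auto simp: hat_Compl)
    then have "C' \<subseteq> hat S (S - Q)"
      by (intro le) auto
    then show False
      using \<alpha>(1) Q by (auto simp: hat_Compl)
  qed
  show ?thesis
    using sub[of C D] sub[of D C] assms by blast
qed

text \<open>
  Compactness of \<^term>\<open>beta S\<close> in filter form. The filter \<open>F\<close> may be improper, in which case
  no ultrafilter extends it.
\<close>

lemma filter_cluster_subset_openin:
  assumes F: "S \<in> F" "\<And>P Q. P \<in> F \<Longrightarrow> Q \<in> F \<Longrightarrow> P \<inter> Q \<in> F"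
      "\<And>P Q. P \<in> F \<Longrightarrow> P \<subseteq> Q \<Longrightarrow> Q \<subseteq> S \<Longrightarrow> Q \<in> F" "F \<subseteq> Pow S"
    and U: "openin (beta S) U"
    and sub: "{\<alpha>. ultrafilter_on S \<alpha> \<and> F \<subseteq> \<alpha>} \<subseteq> U"
  obtains Q where "Q \<in> F" "hat S Q \<subseteq> U"
proof (rule ccontr)
  assume "\<not> thesis"
  then have no: "\<not> hat S Q \<subseteq> U" if "Q \<in> F" for Q
    using that \<open>\<And>Q. Q \<in> F \<Longrightarrow> hat S Q \<subseteq> U \<Longrightarrow> thesis\<close> by blast
  \<comment> \<open>An ultrafilter containing \<open>G\<close> avoids every basic clopen set inside
    \<open>U\<close>, so it lies outside \<open>U\<close>; one containing \<open>F\<close> lies in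
    \<open>U\<close>. A contradiction therefore follows once \<open>F \<union> G\<close> has the
    finite intersection property.\<close>
  define G where "G = {S - P | P. P \<subseteq> S \<and> hat S P \<subseteq> U}"
  have F_Inter: "S \<inter> \<Inter>H \<in> F" if "finite H" "H \<subseteq> F" for H
    using that
  proof induction
    case empty
    then show ?case using F(1) by simp
  next
    case (insert x H)
    have "x \<inter> (S \<inter> \<Inter>H) \<in> F" using insert by (intro F(2)[of x]) simp_all
    then show ?case by (simp add: Int_left_commute)
  qed
  \<comment> \<open>The sets \<open>P\<close> with \<open>hat S P \<subseteq> U\<close> are closed
    under finite unions, since an ultrafilter containing \<open>P \<union> R\<close> contains
    \<open>P\<close> or \<open>R\<close>. So a finite intersection from \<open>G\<close> is again
    the complement of a single such \<open>P\<close>.\<close>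
  have G_Inter: "\<exists>P. P \<subseteq> S \<and> hat S P \<subseteq> U \<and> S - P = S \<inter> \<Inter>H" if "finite H" "H \<subseteq> G" for H
    using that
  proof induction
    case empty
    have "hat S {} = {}"
      using ultrafilter_onD(3) by (auto simp: hat_def)
    then show ?case by (intro exI[of _ "{}"]) auto
  next
    case (insert x H)
    then obtain P where P: "P \<subseteq> S" "hat S P \<subseteq> U" "S - P = S \<inter> \<Inter>H" by auto
    obtain R where R: "R \<subseteq> S" "hat S R \<subseteq> U" "x = S - R"
      using insert.prems unfolding G_def by blast
    have "hat S (P \<union> R) \<subseteq> hat S P \<union> hat S R"
    proof
      fix \<alpha> assume \<alpha>: "\<alpha> \<in> hat S (P \<union> R)"
      then have u: "ultrafilter_on S \<alpha>" by (simp add: hat_def)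
      show "\<alpha> \<in> hat S P \<union> hat S R"
      proof (rule ccontr)
        assume "\<alpha> \<notin> hat S P \<union> hat S R"
        then have "S - P \<in> \<alpha>" "S - R \<in> \<alpha>"
          using u P(1) R(1) by (auto simp: hat_def ultrafilter_on_Compl_iff)
        then have "S - (P \<union> R) \<in> \<alpha>"
          using ultrafilter_onD(4)[OF u] by (simp add: Diff_Un)
        then show False
          using \<alpha> ultrafilter_on_Compl_iff[OF u, of "P \<union> R"] P(1) R(1) by (simp add: hat_def)
      qed
    qed
    then have "hat S (P \<union> R) \<subseteq> U"
      using P(2) R(2) by blast
    moreover have "S - (P \<union> R) = S \<inter> \<Inter>(insert x H)"
      using P(3) R(3) by blast
    ultimately show ?case
      using P(1) R(1) by (intro exI[of _ "P \<union> R"]) auto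
  qed
  have "fip_on S (F \<union> G)"
    unfolding fip_on_def
  proof (intro conjI allI impI)
    show "F \<union> G \<subseteq> Pow S"
      using F(4) by (auto simp: G_def)
    fix H assume H: "finite H \<and> H \<subseteq> F \<union> G"
    obtain P where P: "P \<subseteq> S" "hat S P \<subseteq> U" "S - P = S \<inter> \<Inter>(H \<inter> G)"
      using G_Inter[of "H \<inter> G"] H by auto
    have Q: "S \<inter> \<Inter>(H \<inter> F) \<in> F"
      using H by (intro F_Inter) auto
    show "S \<inter> \<Inter>H \<noteq> {}"
    proof
      assume empty: "S \<inter> \<Inter>H = {}"
      have "H = (H \<inter> F) \<union> (H \<inter> G)"
        using H by blast
      then have "S \<inter> \<Inter>H = (S \<inter> \<Inter>(H \<inter> F)) \<inter> (S \<inter> \<Inter>(H \<inter> G))"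
        by (metis Inter_Un_distrib Int_assoc Int_left_commute inf.idem)
      \<comment> \<open>The part of \<open>H\<close> from \<open>F\<close> would be disjoint from
        \<open>S - P\<close>, which puts \<open>P\<close> into \<open>F\<close> although its clopen
        set lies in \<open>U\<close>.\<close>
      then have "S \<inter> \<Inter>(H \<inter> F) \<subseteq> P"
        using empty P(3)[symmetric] by auto
      then have "P \<in> F"
        by (rule F(3)[OF Q _ P(1)])
      then show False
        using no P(2) by blast
    qed
  qed
  then obtain \<alpha> where \<alpha>: "ultrafilter_on S \<alpha>" "F \<union> G \<subseteq> \<alpha>"
    by (rule fip_extends_to_ultrafilter)
  then have "\<alpha> \<in> U"
    using sub by blast
  then obtain P where P: "P \<subseteq> S" "\<alpha> \<in> hat S P" "hat S P \<subseteq> U"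
    using U openin_betaE by metis
  then have "S - P \<in> \<alpha>"
    using \<alpha>(2) unfolding G_def by blast
  then show False
    using P(2) ultrafilter_on_Compl_iff[OF \<alpha>(1) P(1)] by (simp add: hat_def)
qed

section \<open>Points and subbasic open sets of the Vietoris hyperspace\<close>

lemma topspace_vietoris: "topspace (vietoris X) = Collect (closedin X)"
proof -
  have "{C. closedin X C} = {C. closedin X C \<and> C \<subseteq> topspace X}"
    using closedin_subset by blast
  then show ?thesis
    unfolding vietoris_def topology_generated_by_topspace
    using openin_topspace[of X] by blast
qed

lemma openin_vietoris_subset:
  "openin X U \<Longrightarrow> openin (vietoris X) {C. closedin X C \<and> C \<subseteq> U}"
  unfolding vietoris_def by (rule topology_generated_by_Basis) blast

lemma openin_vietoris_meets:
  "openin X U \<Longrightarrow> openin (vietoris X) {C. closedin X C \<and> C \<inter> U \<noteq> {}}"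
  unfolding vietoris_def by (rule topology_generated_by_Basis) blast

section \<open>The extension to ultrafilters on words\<close>

text \<open>The value may be empty: for an ultrafilter \<open>\<gamma>\<close> and a
  \<open>k\<close>-tuple \<open>a\<close> over \<open>A\<close> this happens exactly when
  \<open>L_box A a {} \<in> \<gamma>\<close>, that is, when the filter to be extended is
  improper.\<close>

definition box_cluster ::
    "'a set \<Rightarrow> nat \<Rightarrow> 'a list set set \<Rightarrow> 'a list \<Rightarrow> nat list set set set" where
  "box_cluster A k \<gamma> a = {\<alpha>. ultrafilter_on (nat_tuples k) \<alpha> \<and>
     {Q. Q \<subseteq> nat_tuples k \<and> L_box A a Q \<in> \<gamma>} \<subseteq> \<alpha>}"

lemma L_box_subset: "L_box A a Q \<subseteq> lists A"
  by (auto simp: L_box_def)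

lemma L_box_mono: "P \<subseteq> Q \<Longrightarrow> L_box A a P \<subseteq> L_box A a Q"
  by (auto simp: L_box_def)

lemma L_box_Int: "L_box A a (P \<inter> Q) = L_box A a P \<inter> L_box A a Q"
  by (auto simp: L_box_def)

lemma cpos_subset: "a \<in> tuples k A \<Longrightarrow> cpos a w \<subseteq> nat_tuples k"
  by (auto simp: cpos_def tuples_def)

lemma L_box_nat_tuples: "a \<in> tuples k A \<Longrightarrow> L_box A a (nat_tuples k) = lists A"
  using cpos_subset[of a k A] by (auto simp: L_box_def)

text \<open>Since \<open>cpos a w\<close> consists of \<open>k\<close>-tuples, it meets
  \<open>Q\<close> exactly when it is not contained in the complement of \<open>Q\<close>. This
  duality turns every statement about boxes into one about diamonds.\<close>

lemma L_diamond_eq_Diff_L_box: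
  assumes "a \<in> tuples k A"
  shows "L_diamond A a Q = lists A - L_box A a (nat_tuples k - Q)"
  using cpos_subset[OF assms] unfolding L_diamond_def L_box_def by blast

lemma L_box_mem_mono:
  assumes "ultrafilter_on (lists A) \<gamma>" "L_box A a P \<in> \<gamma>" "P \<subseteq> Q"
  shows "L_box A a Q \<in> \<gamma>"
  using ultrafilter_onD(5)[OF assms(1,2) L_box_mono[OF assms(3)] L_box_subset] .

text \<open>The sets \<open>Q\<close> with \<open>L_box A a Q \<in> \<gamma>\<close> form a possibly
  improper filter, because \<open>L_box\<close> is monotone and commutes with intersections. The
  forward direction is then compactness in the form of
  \<open>filter_cluster_subset_openin\<close>.\<close>

lemma box_cluster_subset_openin_iff:
  assumes \<gamma>: "ultrafilter_on (lists A) \<gamma>" and a: "a \<in> tuples k A"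
    and U: "openin (beta (nat_tuples k)) U"
  shows "box_cluster A k \<gamma> a \<subseteq> U \<longleftrightarrow>
    (\<exists>Q. Q \<subseteq> nat_tuples k \<and> L_box A a Q \<in> \<gamma> \<and> hat (nat_tuples k) Q \<subseteq> U)"
proof
  let ?F = "{Q. Q \<subseteq> nat_tuples k \<and> L_box A a Q \<in> \<gamma>}"
  assume sub: "box_cluster A k \<gamma> a \<subseteq> U"
  have 1: "nat_tuples k \<in> ?F"
    using ultrafilter_onD(2)[OF \<gamma>] L_box_nat_tuples[OF a] by simp
  have 2: "P \<inter> Q \<in> ?F" if "P \<in> ?F" "Q \<in> ?F" for P Q
    using that ultrafilter_onD(4)[OF \<gamma>] by (auto simp: L_box_Int)
  have 3: "Q \<in> ?F" if "P \<in> ?F" "P \<subseteq> Q" "Q \<subseteq> nat_tuples k" for P Q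
    using that L_box_mem_mono[OF \<gamma>, of a P Q] by simp
  obtain Q where "Q \<in> ?F" "hat (nat_tuples k) Q \<subseteq> U"
    by (rule filter_cluster_subset_openin[OF 1 2 3 _ U])
      (use sub in \<open>auto simp: box_cluster_def\<close>)
  then show "\<exists>Q. Q \<subseteq> nat_tuples k \<and> L_box A a Q \<in> \<gamma> \<and> hat (nat_tuples k) Q \<subseteq> U"
    by blast
next
  assume "\<exists>Q. Q \<subseteq> nat_tuples k \<and> L_box A a Q \<in> \<gamma> \<and> hat (nat_tuples k) Q \<subseteq> U"
  then show "box_cluster A k \<gamma> a \<subseteq> U"
    unfolding box_cluster_def hat_def by blast
qed

text \<open>The closed set of ultrafilters gives back the filter defining it: compactness yields a
  member \<open>P\<close> of the filter with \<open>hat (nat_tuples k) P\<close> inside the clopen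
  set of \<open>Q\<close>, hence \<open>P \<subseteq> Q\<close>, and filters are upward
  closed.\<close>

lemma box_cluster_subset_hat_iff:
  assumes \<gamma>: "ultrafilter_on (lists A) \<gamma>" and a: "a \<in> tuples k A" and Q: "Q \<subseteq> nat_tuples k"
  shows "box_cluster A k \<gamma> a \<subseteq> hat (nat_tuples k) Q \<longleftrightarrow> L_box A a Q \<in> \<gamma>"
proof
  assume "box_cluster A k \<gamma> a \<subseteq> hat (nat_tuples k) Q"
  then obtain P where P: "P \<subseteq> nat_tuples k" "L_box A a P \<in> \<gamma>"
      "hat (nat_tuples k) P \<subseteq> hat (nat_tuples k) Q"
    using box_cluster_subset_openin_iff[OF \<gamma> a openin_beta_hat[OF Q]] by blast
  then have "P \<subseteq> Q"
    using Q by (simp add: hat_subset_hat_iff)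
  then show "L_box A a Q \<in> \<gamma>"
    by (rule L_box_mem_mono[OF \<gamma> P(2)])
next
  assume "L_box A a Q \<in> \<gamma>"
  then show "box_cluster A k \<gamma> a \<subseteq> hat (nat_tuples k) Q"
    using Q unfolding box_cluster_def hat_def by blast
qed

text \<open>For a basic clopen set in place of \<open>U\<close>, this is the box criterion for the
  complement. A general open \<open>U\<close> is a union of basic clopen sets, and meeting a union
  means meeting one of its members.\<close>

lemma box_cluster_meets_openin_iff:
  assumes \<gamma>: "ultrafilter_on (lists A) \<gamma>" and a: "a \<in> tuples k A"
    and U: "openin (beta (nat_tuples k)) U"
  shows "box_cluster A k \<gamma> a \<inter> U \<noteq> {} \<longleftrightarrow>
    (\<exists>Q. Q \<subseteq> nat_tuples k \<and> L_diamond A a Q \<in> \<gamma> \<and> hat (nat_tuples k) Q \<subseteq> U)"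
proof -
  have sub: "box_cluster A k \<gamma> a \<subseteq> topspace (beta (nat_tuples k))"
    by (auto simp: box_cluster_def topspace_beta)
  have *: "box_cluster A k \<gamma> a \<inter> hat (nat_tuples k) Q \<noteq> {} \<longleftrightarrow> L_diamond A a Q \<in> \<gamma>"
    if Q: "Q \<subseteq> nat_tuples k" for Q
  proof -
    have "box_cluster A k \<gamma> a \<inter> hat (nat_tuples k) Q = {} \<longleftrightarrow>
        box_cluster A k \<gamma> a \<subseteq> hat (nat_tuples k) (nat_tuples k - Q)"
      using sub unfolding hat_Compl[OF Q] by blast
    also have "\<dots> \<longleftrightarrow> L_box A a (nat_tuples k - Q) \<in> \<gamma>"
      by (rule box_cluster_subset_hat_iff[OF \<gamma> a]) blast
    finally show ?thesis
      unfolding L_diamond_eq_Diff_L_box[OF a] ultrafilter_on_Compl_iff[OF \<gamma> L_box_subset]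
      by simp
  qed
  show ?thesis
  proof
    assume "box_cluster A k \<gamma> a \<inter> U \<noteq> {}"
    then obtain \<alpha> where \<alpha>: "\<alpha> \<in> box_cluster A k \<gamma> a" "\<alpha> \<in> U" by blast
    then obtain Q where "Q \<subseteq> nat_tuples k" "\<alpha> \<in> hat (nat_tuples k) Q" "hat (nat_tuples k) Q \<subseteq> U"
      using openin_betaE[OF U] by metis
    then show "\<exists>Q. Q \<subseteq> nat_tuples k \<and> L_diamond A a Q \<in> \<gamma> \<and> hat (nat_tuples k) Q \<subseteq> U"
      using * \<alpha>(1) by blast
  qed (use * in blast)
qed

lemma closedin_box_cluster:
  assumes "ultrafilter_on (lists A) \<gamma>" "a \<in> tuples k A"
  shows "closedin (beta (nat_tuples k)) (box_cluster A k \<gamma> a)"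
proof -
  let ?F = "{Q. Q \<subseteq> nat_tuples k \<and> L_box A a Q \<in> \<gamma>}"
  have ne: "nat_tuples k \<in> ?F"
    using ultrafilter_onD(2)[OF assms(1)] L_box_nat_tuples[OF assms(2)] by simp
  then have "box_cluster A k \<gamma> a = \<Inter>(hat (nat_tuples k) ` ?F)"
    unfolding box_cluster_def hat_def by blast
  also have "closedin (beta (nat_tuples k)) \<dots>"
    using ne by (intro closedin_Inter) (auto intro: closedin_beta_hat)
  finally show ?thesis .
qed

text \<open>It suffices to test the two kinds of subbasic Vietoris sets. Their preimages are unions
  of clopen sets given by the languages \<open>L_box A a Q\<close> and
  \<open>L_diamond A a Q\<close> respectively, where \<open>Q\<close> ranges over the sets whose
  clopen set lies in \<open>U\<close>.\<close>

lemma continuous_map_box_cluster: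
  assumes a: "a \<in> tuples k A"
  shows "continuous_map (beta (lists A)) (vietoris (beta (nat_tuples k)))
    (\<lambda>\<gamma>. box_cluster A k \<gamma> a)"
  unfolding vietoris_def
proof (rule continuous_on_generated_topo)
  let ?T = "topspace (beta (lists A))" and ?S = "nat_tuples k"
  fix V
  assume "V \<in> {{C. closedin (beta ?S) C \<and> C \<subseteq> U} | U. openin (beta ?S) U} \<union>
    {{C. closedin (beta ?S) C \<and> C \<inter> U \<noteq> {}} | U. openin (beta ?S) U}"
  then consider U where "openin (beta ?S) U" "V = {C. closedin (beta ?S) C \<and> C \<subseteq> U}"
    | U where "openin (beta ?S) U" "V = {C. closedin (beta ?S) C \<and> C \<inter> U \<noteq> {}}"
    by blast
  then show "openin (beta (lists A)) ((\<lambda>\<gamma>. box_cluster A k \<gamma> a) -` V \<inter> ?T)"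
  proof cases
    case 1
    have "(\<lambda>\<gamma>. box_cluster A k \<gamma> a) -` V \<inter> ?T =
        (\<Union>Q\<in>{Q. Q \<subseteq> ?S \<and> hat ?S Q \<subseteq> U}. hat (lists A) (L_box A a Q))"
    proof (rule set_eqI)
      fix \<gamma>
      show "\<gamma> \<in> (\<lambda>\<gamma>. box_cluster A k \<gamma> a) -` V \<inter> ?T \<longleftrightarrow>
          \<gamma> \<in> (\<Union>Q\<in>{Q. Q \<subseteq> ?S \<and> hat ?S Q \<subseteq> U}. hat (lists A) (L_box A a Q))"
      proof (cases "ultrafilter_on (lists A) \<gamma>")
        case True
        then have "\<gamma> \<in> (\<lambda>\<gamma>. box_cluster A k \<gamma> a) -` V \<inter> ?T \<longleftrightarrow>
            (\<exists>Q. Q \<subseteq> ?S \<and> L_box A a Q \<in> \<gamma> \<and> hat ?S Q \<subseteq> U)"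
          unfolding box_cluster_subset_openin_iff[OF True a 1(1), symmetric]
          by (simp add: 1(2) topspace_beta closedin_box_cluster[OF True a])
        then show ?thesis
          using True by (auto simp: hat_def[of "lists A"])
      qed (auto simp: topspace_beta hat_def[of "lists A"])
    qed
    then show ?thesis
      by (auto intro!: openin_Union openin_beta_hat dest: subsetD[OF L_box_subset])
  next
    case 2
    have "(\<lambda>\<gamma>. box_cluster A k \<gamma> a) -` V \<inter> ?T =
        (\<Union>Q\<in>{Q. Q \<subseteq> ?S \<and> hat ?S Q \<subseteq> U}. hat (lists A) (L_diamond A a Q))"
    proof (rule set_eqI)
      fix \<gamma>
      show "\<gamma> \<in> (\<lambda>\<gamma>. box_cluster A k \<gamma> a) -` V \<inter> ?T \<longleftrightarrow>
          \<gamma> \<in> (\<Union>Q\<in>{Q. Q \<subseteq> ?S \<and> hat ?S Q \<subseteq> U}. hat (lists A) (L_diamond A a Q))"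
      proof (cases "ultrafilter_on (lists A) \<gamma>")
        case True
        then have "\<gamma> \<in> (\<lambda>\<gamma>. box_cluster A k \<gamma> a) -` V \<inter> ?T \<longleftrightarrow>
            (\<exists>Q. Q \<subseteq> ?S \<and> L_diamond A a Q \<in> \<gamma> \<and> hat ?S Q \<subseteq> U)"
          unfolding box_cluster_meets_openin_iff[OF True a 2(1), symmetric]
          by (simp add: 2(2) topspace_beta closedin_box_cluster[OF True a])
        then show ?thesis
          using True by (auto simp: hat_def[of "lists A"])
      qed (auto simp: topspace_beta hat_def[of "lists A"])
    qed
    then show ?thesis
      by (auto intro!: openin_Union openin_beta_hat simp: L_diamond_def)
  qed
next
  have "(\<lambda>\<gamma>. box_cluster A k \<gamma> a) ` topspace (beta (lists A))
      \<subseteq> topspace (vietoris (beta (nat_tuples k)))"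
    using closedin_box_cluster[OF _ a] by (auto simp: topspace_beta topspace_vietoris)
  then show "(\<lambda>\<gamma>. box_cluster A k \<gamma> a) ` topspace (beta (lists A)) \<subseteq>
    \<Union>({{C. closedin (beta (nat_tuples k)) C \<and> C \<subseteq> U} | U. openin (beta (nat_tuples k)) U} \<union>
      {{C. closedin (beta (nat_tuples k)) C \<and> C \<inter> U \<noteq> {}} | U. openin (beta (nat_tuples k)) U})"
    unfolding vietoris_def topology_generated_by_topspace .
qed

text \<open>For the principal ultrafilter of \<open>w\<close>, the filter consists of all supersets
  of \<open>cpos a w\<close> among the sets of \<open>k\<close>-tuples, so an ultrafilter extends it
  as soon as it contains \<open>cpos a w\<close>.\<close>

lemma box_cluster_principal:
  assumes w: "w \<in> lists A" and a: "a \<in> tuples k A"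
  shows "box_cluster A k (principal_ultrafilter (lists A) w) a = hat (nat_tuples k) (cpos a w)"
proof -
  have "L_box A a Q \<in> principal_ultrafilter (lists A) w \<longleftrightarrow> cpos a w \<subseteq> Q" for Q
    using w by (auto simp: principal_ultrafilter_def L_box_def)
  then have "box_cluster A k (principal_ultrafilter (lists A) w) a =
      {\<alpha>. ultrafilter_on (nat_tuples k) \<alpha> \<and> {Q. Q \<subseteq> nat_tuples k \<and> cpos a w \<subseteq> Q} \<subseteq> \<alpha>}"
    by (simp add: box_cluster_def)
  then show ?thesis
    using cpos_subset[OF a, of w] by (auto simp: hat_def intro: ultrafilter_onD(5))
qed

text \<open>The heart of uniqueness. Being contained in a clopen set and failing to be so are both
  open conditions in the Vietoris topology. By continuity, whichever holds at
  \<open>\<gamma>\<close> also holds at the principal ultrafilters of all words in some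
  \<open>P \<in> \<gamma>\<close>, where the values of \<open>g\<close> are known.\<close>

lemma continuous_extension_subset_hat_iff:
  assumes g: "continuous_map (beta (lists A)) (vietoris (beta (nat_tuples k))) g"
    and gw: "\<And>w. w \<in> lists A \<Longrightarrow>
      g (principal_ultrafilter (lists A) w) = hat (nat_tuples k) (cpos a w)"
    and \<gamma>: "ultrafilter_on (lists A) \<gamma>" and a: "a \<in> tuples k A" and Q: "Q \<subseteq> nat_tuples k"
  shows "g \<gamma> \<subseteq> hat (nat_tuples k) Q \<longleftrightarrow> L_box A a Q \<in> \<gamma>"
proof -
  let ?S = "nat_tuples k"
  have g_closed: "closedin (beta ?S) (g \<gamma>)"
    using continuous_map_funspace[OF g] \<gamma> by (auto simp: topspace_beta topspace_vietoris)
  \<comment> \<open>Density of the words in quantitative form: a basic neighbourhood of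
    \<open>\<gamma>\<close> inside the preimage of \<open>V\<close> is given by a set
    \<open>P \<in> \<gamma>\<close>, and it contains the principal ultrafilters of all words in
    \<open>P\<close>.\<close>
  have nhd: "\<exists>P\<in>\<gamma>. P \<subseteq> lists A \<and> (\<forall>w\<in>P. hat ?S (cpos a w) \<in> V)"
    if V: "openin (vietoris (beta ?S)) V" "g \<gamma> \<in> V" for V
  proof -
    have "openin (beta (lists A)) {\<delta> \<in> topspace (beta (lists A)). g \<delta> \<in> V}"
      using g V(1) by (rule openin_continuous_map_preimage)
    moreover have "\<gamma> \<in> {\<delta> \<in> topspace (beta (lists A)). g \<delta> \<in> V}"
      using \<gamma> V(2) by (simp add: topspace_beta)
    ultimately obtain P where P: "P \<subseteq> lists A" "\<gamma> \<in> hat (lists A) P"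
        "hat (lists A) P \<subseteq> {\<delta> \<in> topspace (beta (lists A)). g \<delta> \<in> V}"
      by (rule openin_betaE)
    have "hat ?S (cpos a w) \<in> V" if w: "w \<in> P" for w
    proof -
      have "principal_ultrafilter (lists A) w \<in> hat (lists A) P"
        using w P(1) ultrafilter_on_principal[of w "lists A"]
        by (auto simp: hat_def principal_ultrafilter_def)
      then have "g (principal_ultrafilter (lists A) w) \<in> V"
        using P(3) by blast
      then show ?thesis
        using gw[of w] w P(1) by (simp add: subset_iff)
    qed
    then show ?thesis
      using P(1,2) by (auto simp: hat_def)
  qed
  have sub_iff: "hat ?S (cpos a w) \<subseteq> hat ?S Q \<longleftrightarrow> cpos a w \<subseteq> Q" for w
    using cpos_subset[OF a] Q by (rule hat_subset_hat_iff)
  show ?thesis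
  proof
    assume "g \<gamma> \<subseteq> hat ?S Q"
    then obtain P where P: "P \<in> \<gamma>" "P \<subseteq> lists A" "\<forall>w\<in>P. hat ?S (cpos a w) \<subseteq> hat ?S Q"
      using nhd[OF openin_vietoris_subset[OF openin_beta_hat[OF Q]]] g_closed by blast
    then have "P \<subseteq> L_box A a Q"
      unfolding sub_iff L_box_def by blast
    then show "L_box A a Q \<in> \<gamma>"
      using ultrafilter_onD(5)[OF \<gamma> P(1) _ L_box_subset] by blast
  next
    assume box: "L_box A a Q \<in> \<gamma>"
    show "g \<gamma> \<subseteq> hat ?S Q"
    proof (rule ccontr)
      have hC: "hat ?S (?S - Q) = topspace (beta ?S) - hat ?S Q"
        using Q by (rule hat_Compl)
      assume "\<not> g \<gamma> \<subseteq> hat ?S Q"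
      \<comment> \<open>Non-inclusion is rewritten as meeting the complementary clopen set, so that
        \<open>nhd\<close> applies; the resulting \<open>P \<in> \<gamma>\<close> is disjoint from
        \<open>L_box A a Q \<in> \<gamma>\<close>.\<close>
      then have "g \<gamma> \<inter> hat ?S (?S - Q) \<noteq> {}"
        using closedin_subset[OF g_closed] unfolding hC by blast
      then obtain P where P: "P \<in> \<gamma>" "P \<subseteq> lists A"
          "\<forall>w\<in>P. hat ?S (cpos a w) \<inter> hat ?S (?S - Q) \<noteq> {}"
        using nhd[OF openin_vietoris_meets[OF openin_beta_hat[of "?S - Q" ?S]]] g_closed
        by blast
      then have "\<not> cpos a w \<subseteq> Q" if "w \<in> P" for w
        using that unfolding sub_iff[symmetric] hC by blast
      then have "P \<inter> L_box A a Q = {}"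
        unfolding L_box_def by blast
      then show False
        using ultrafilter_onD(3,4)[OF \<gamma>] P(1) box by metis
    qed
  qed
qed

text \<open>Existence is the continuity of each component together with the values at principal
  ultrafilters. For uniqueness, each component of a competitor \<open>g\<close> at
  \<open>\<gamma>\<close> is a closed set contained in the same clopen sets as
  \<open>box_cluster A k \<gamma> a\<close>; extensionality settles the remaining arguments.\<close>

lemma c_ext_eq:
  "c_ext A k = (\<lambda>\<gamma>\<in>topspace (beta (lists A)). \<lambda>a\<in>tuples k A. box_cluster A k \<gamma> a)"
  (is "_ = ?f")
  unfolding c_ext_def
proof (rule the_equality, intro conjI ballI)
  show "?f \<in> extensional (topspace (beta (lists A)))"
    by simp
  have "continuous_map (beta (lists A)) (V_space A k)
      (\<lambda>\<gamma>. \<lambda>a\<in>tuples k A. box_cluster A k \<gamma> a)"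
    unfolding V_space_def continuous_map_componentwise
    using continuous_map_box_cluster by auto
  then show "continuous_map (beta (lists A)) (V_space A k) ?f"
    by (rule continuous_map_eq) simp
  fix w assume w: "w \<in> lists A"
  then show "?f (principal_ultrafilter (lists A) w) =
      (\<lambda>a\<in>tuples k A. hat (nat_tuples k) (cpos a w))"
    using ultrafilter_on_principal[OF w] box_cluster_principal[OF w]
    by (simp add: topspace_beta cong: restrict_cong)
next
  fix g
  assume g: "g \<in> extensional (topspace (beta (lists A))) \<and>
    continuous_map (beta (lists A)) (V_space A k) g \<and>
    (\<forall>w\<in>lists A. g (principal_ultrafilter (lists A) w) =
      (\<lambda>a\<in>tuples k A. hat (nat_tuples k) (cpos a w)))"
  have ext: "g ` topspace (beta (lists A)) \<subseteq> extensional (tuples k A)"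
    and comp: "\<And>a. a \<in> tuples k A \<Longrightarrow>
      continuous_map (beta (lists A)) (vietoris (beta (nat_tuples k))) (\<lambda>\<gamma>. g \<gamma> a)"
    using g unfolding V_space_def continuous_map_componentwise by auto
  show "g = ?f"
  proof (rule extensionalityI)
    show "g \<in> extensional (topspace (beta (lists A)))"
      using g by blast
    show "?f \<in> extensional (topspace (beta (lists A)))"
      by simp
    fix \<gamma> assume \<gamma>: "\<gamma> \<in> topspace (beta (lists A))"
    then have u: "ultrafilter_on (lists A) \<gamma>"
      by (simp add: topspace_beta)
    have "g \<gamma> = (\<lambda>a\<in>tuples k A. box_cluster A k \<gamma> a)"
    proof (rule extensionalityI)
      show "g \<gamma> \<in> extensional (tuples k A)"
        using ext \<gamma> by blast
      show "(\<lambda>a\<in>tuples k A. box_cluster A k \<gamma> a) \<in> extensional (tuples k A)"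
        by simp
      fix a assume a: "a \<in> tuples k A"
      have "g \<gamma> a = box_cluster A k \<gamma> a"
      proof (rule closedin_beta_eqI)
        show "closedin (beta (nat_tuples k)) (g \<gamma> a)"
          using continuous_map_funspace[OF comp[OF a]] \<gamma> by (auto simp: topspace_vietoris)
        show "closedin (beta (nat_tuples k)) (box_cluster A k \<gamma> a)"
          using u a by (rule closedin_box_cluster)
        fix Q :: "nat list set" assume Q: "Q \<subseteq> nat_tuples k"
        have "g \<gamma> a \<subseteq> hat (nat_tuples k) Q \<longleftrightarrow> L_box A a Q \<in> \<gamma>"
          using g a
          by (intro continuous_extension_subset_hat_iff[OF comp[OF a] _ u a Q]) auto
        then show "g \<gamma> a \<subseteq> hat (nat_tuples k) Q \<longleftrightarrow>
            box_cluster A k \<gamma> a \<subseteq> hat (nat_tuples k) Q"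
          using box_cluster_subset_hat_iff[OF u a Q] by simp
      qed
      then show "g \<gamma> a = (\<lambda>a\<in>tuples k A. box_cluster A k \<gamma> a) a"
        using a by simp
    qed
    then show "g \<gamma> = ?f \<gamma>"
      using \<gamma> by simp
  qed
qed

section \<open>Recognising the points of the image by boxes and diamonds\<close>

lemma topspace_V_space:
  "topspace (V_space A k) = (\<Pi>\<^sub>E a\<in>tuples k A. Collect (closedin (beta (nat_tuples k))))"
  by (simp add: V_space_def topspace_product_topology topspace_vietoris)

text \<open>The condition on the right prescribes which clopen sets contain \<open>C a\<close>, and
  this determines the closed set \<open>C a\<close>. Outside \<open>tuples k A\<close> both families
  take the default value.\<close>

lemma eq_c_ext_iff:
  assumes C: "C \<in> topspace (V_space A k)" and \<gamma>: "\<gamma> \<in> topspace (beta (lists A))"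
  shows "C = c_ext A k \<gamma> \<longleftrightarrow> (\<forall>a\<in>tuples k A. \<forall>Q. Q \<subseteq> nat_tuples k \<longrightarrow>
    (C a \<subseteq> hat (nat_tuples k) Q \<longleftrightarrow> L_box A a Q \<in> \<gamma>))" (is "_ \<longleftrightarrow> ?R")
proof -
  have u: "ultrafilter_on (lists A) \<gamma>"
    using \<gamma> by (simp add: topspace_beta)
  have val: "c_ext A k \<gamma> = (\<lambda>a\<in>tuples k A. box_cluster A k \<gamma> a)"
    using \<gamma> by (simp add: c_ext_eq)
  show ?thesis
  proof
    assume "C = c_ext A k \<gamma>"
    then show ?R
      using box_cluster_subset_hat_iff[OF u] by (simp add: val)
  next
    assume R: ?R
    show "C = c_ext A k \<gamma>"
      unfolding val
    proof (rule extensionalityI)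
      show "C \<in> extensional (tuples k A)"
        using C by (auto simp: topspace_V_space PiE_def)
      show "(\<lambda>a\<in>tuples k A. box_cluster A k \<gamma> a) \<in> extensional (tuples k A)"
        by simp
      fix a assume a: "a \<in> tuples k A"
      have "C a = box_cluster A k \<gamma> a"
      proof (rule closedin_beta_eqI)
        show "closedin (beta (nat_tuples k)) (C a)"
          using C a by (auto simp: topspace_V_space)
        show "closedin (beta (nat_tuples k)) (box_cluster A k \<gamma> a)"
          using u a by (rule closedin_box_cluster)
      qed (use R a box_cluster_subset_hat_iff[OF u a] in simp)
      then show "C a = (\<lambda>a\<in>tuples k A. box_cluster A k \<gamma> a) a"
        using a by simp
    qed
  qed
qed

text \<open>The diamond condition at \<open>Q\<close> is the negation of both sides of the box
  condition at the complement of \<open>Q\<close>, and complementation permutes the subsets of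
  \<open>nat_tuples k\<close>.\<close>

lemma box_iff_diamond:
  assumes C: "closedin (beta (nat_tuples k)) C" and \<gamma>: "\<gamma> \<in> topspace (beta (lists A))"
    and a: "a \<in> tuples k A"
  shows "(\<forall>Q. Q \<subseteq> nat_tuples k \<longrightarrow> (C \<subseteq> hat (nat_tuples k) Q \<longleftrightarrow> L_box A a Q \<in> \<gamma>)) \<longleftrightarrow>
    (\<forall>Q. Q \<subseteq> nat_tuples k \<longrightarrow> (C \<inter> hat (nat_tuples k) Q \<noteq> {} \<longleftrightarrow> L_diamond A a Q \<in> \<gamma>))"
    (is "(\<forall>Q. _ \<longrightarrow> ?B Q) \<longleftrightarrow> (\<forall>Q. _ \<longrightarrow> ?D Q)")
proof -
  let ?S = "nat_tuples k"
  have u: "ultrafilter_on (lists A) \<gamma>"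
    using \<gamma> by (simp add: topspace_beta)
  have dual: "?D Q \<longleftrightarrow> ?B (?S - Q)" if Q: "Q \<subseteq> ?S" for Q
  proof -
    have "C \<inter> hat ?S Q \<noteq> {} \<longleftrightarrow> \<not> C \<subseteq> hat ?S (?S - Q)"
      using closedin_subset[OF C] unfolding hat_Compl[OF Q] by blast
    moreover have "L_diamond A a Q \<in> \<gamma> \<longleftrightarrow> L_box A a (?S - Q) \<notin> \<gamma>"
      unfolding L_diamond_eq_Diff_L_box[OF a] by (rule ultrafilter_on_Compl_iff[OF u L_box_subset])
    ultimately show ?thesis
      by blast
  qed
  show ?thesis
  proof (rule iffI; intro allI impI)
    fix Q :: "nat list set" assume B: "\<forall>Q. Q \<subseteq> ?S \<longrightarrow> ?B Q" and Q: "Q \<subseteq> ?S"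
    show "?D Q"
      using B by (intro iffD2[OF dual[OF Q]]) simp
  next
    fix Q :: "nat list set" assume D: "\<forall>Q. Q \<subseteq> ?S \<longrightarrow> ?D Q" and Q: "Q \<subseteq> ?S"
    \<comment> \<open>The duality is used at \<open>?S - Q\<close>, so that the double complement
      returns the box condition at \<open>Q\<close> itself.\<close>
    have "?B (?S - (?S - Q))"
      using D by (intro iffD1[OF dual]) simp_all
    then show "?B Q"
      using Q by (simp add: double_diff)
  qed
qed

theorem mainTheorem4:
  fixes A :: "'a set" and k :: nat and C :: "'a list \<Rightarrow> nat list set set set"
  assumes "finite A" and "k \<ge> 1" and "C \<in> topspace (V_space A k)"
  shows
    "(C \<in> topspace (X_space A k) \<longleftrightarrow>
        (\<exists>\<gamma>\<in>topspace (beta (lists A)). \<forall>a\<in>tuples k A. \<forall>Q. Q \<subseteq> nat_tuples k \<longrightarrow>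
           (C a \<subseteq> hat (nat_tuples k) Q \<longleftrightarrow> L_box A a Q \<in> \<gamma>))) \<and>
     (C \<in> topspace (X_space A k) \<longleftrightarrow>
        (\<exists>\<gamma>\<in>topspace (beta (lists A)). \<forall>a\<in>tuples k A. \<forall>Q. Q \<subseteq> nat_tuples k \<longrightarrow>
           (C a \<inter> hat (nat_tuples k) Q \<noteq> {} \<longleftrightarrow> L_diamond A a Q \<in> \<gamma>))) \<and>
     (\<forall>\<gamma>\<in>topspace (beta (lists A)).
        (\<forall>a\<in>tuples k A. \<forall>Q. Q \<subseteq> nat_tuples k \<longrightarrow>
           (C a \<subseteq> hat (nat_tuples k) Q \<longleftrightarrow> L_box A a Q \<in> \<gamma>)) \<longleftrightarrow>
        (\<forall>a\<in>tuples k A. \<forall>Q. Q \<subseteq> nat_tuples k \<longrightarrow>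
           (C a \<inter> hat (nat_tuples k) Q \<noteq> {} \<longleftrightarrow> L_diamond A a Q \<in> \<gamma>)))"
proof -
  let ?box = "\<lambda>\<gamma>. \<forall>a\<in>tuples k A. \<forall>Q. Q \<subseteq> nat_tuples k \<longrightarrow>
    (C a \<subseteq> hat (nat_tuples k) Q \<longleftrightarrow> L_box A a Q \<in> \<gamma>)"
  let ?dia = "\<lambda>\<gamma>. \<forall>a\<in>tuples k A. \<forall>Q. Q \<subseteq> nat_tuples k \<longrightarrow>
    (C a \<inter> hat (nat_tuples k) Q \<noteq> {} \<longleftrightarrow> L_diamond A a Q \<in> \<gamma>)"
  have "C \<in> topspace (X_space A k) \<longleftrightarrow> (\<exists>\<gamma>\<in>topspace (beta (lists A)). C = c_ext A k \<gamma>)"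
    using assms(3) unfolding X_space_def topspace_subtopology by blast
  then have box: "C \<in> topspace (X_space A k) \<longleftrightarrow> (\<exists>\<gamma>\<in>topspace (beta (lists A)). ?box \<gamma>)"
    using eq_c_ext_iff[OF assms(3)] by simp
  have "closedin (beta (nat_tuples k)) (C a)" if "a \<in> tuples k A" for a
    using assms(3) that by (auto simp: topspace_V_space)
  \<comment> \<open>The two conditions agree for each single \<open>\<gamma>\<close>, so the same
    ultrafilter witnesses both characterisations.\<close>
  then have dual: "?box \<gamma> \<longleftrightarrow> ?dia \<gamma>" if "\<gamma> \<in> topspace (beta (lists A))" for \<gamma>
    by (intro ball_cong[OF refl] box_iff_diamond[OF _ that])
  have dia: "C \<in> topspace (X_space A k) \<longleftrightarrow> (\<exists>\<gamma>\<in>topspace (beta (lists A)). ?dia \<gamma>)"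
    unfolding box by (intro bex_cong[OF refl] dual)
  show ?thesis
    by (intro conjI ballI box dia dual)
qed

end
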